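(* For every lazy simple random walk $(S_n)_{n=0}^\infty$ on $\mathbb{Z}$, every positive integer $k$, and for the number $p_k=\log_2\binom{2k}{k}$, the estimate $$\mathbb{P}(S_k=0)^{1/p_k} \leq \mathbb{P}(S_k=-k)^{1/p_k} + \mathbb{P}(S_k=k)^{1/p_k}$$ holds. Moreover, for each fixed positive integer $k$, the number $p_k$ is the smallest positive real number $p$ such that $$\mathbb{P}(S_k=0)^{1/p} \leq \mathbb{P}(S_k=-k)^{1/p} + \mathbb{P}(S_k=k)^{1/p}$$ holds for every lazy simple random walk $(S_n)_{n=0}^\infty$ on $\mathbb{Z}$.
   Context: A lazy simple random walk on $\mathbb{Z}$ (not necessarily symmetric) is a process $S_n=X_1+\cdots+X_n$, $S_0=0$, where $X_1,X_2,\ldots$ are independent identically distributed random variables taking values in $\{-1,0,1\}$ with $\mathbb{P}(X_1=0)=1/2$. The probability $\mathbb{P}(X_1=1)$ may be any number in $[0,1/2]$, and it determines the distribution of the process. *)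

theory Defs
  imports "HOL-Probability.Probability"
begin

definition lazy_simple_random_walk :: "'a measure \<Rightarrow> (nat \<Rightarrow> 'a \<Rightarrow> int) \<Rightarrow> bool" where
  "lazy_simple_random_walk M S \<longleftrightarrow>
     prob_space M \<and>
     (\<exists>X :: nat \<Rightarrow> 'a \<Rightarrow> int.
        prob_space.indep_vars M (\<lambda>_. count_space UNIV) X {1..} \<and>
        (\<forall>i\<ge>1. distr M (count_space UNIV) (X i) = distr M (count_space UNIV) (X 1)) \<and>
        (\<forall>i\<ge>1. \<forall>\<omega>\<in>space M. X i \<omega> \<in> {-1, 0, 1}) \<and>
        \<P>(\<omega> in M. X 1 \<omega> = 0) = 1 / 2 \<and>
        (\<forall>n. \<forall>\<omega>\<in>space M. S n \<omega> = (\<Sum>i=1..n. X i \<omega>)))"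

definition walk_estimate :: "'a measure \<Rightarrow> (nat \<Rightarrow> 'a \<Rightarrow> int) \<Rightarrow> nat \<Rightarrow> real \<Rightarrow> bool" where
  "walk_estimate M S k p \<longleftrightarrow>
     \<P>(\<omega> in M. S k \<omega> = 0) powr (1 / p)
       \<le> \<P>(\<omega> in M. S k \<omega> = - int k) powr (1 / p) + \<P>(\<omega> in M. S k \<omega> = int k) powr (1 / p)"

text \<open>
  A formula cannot quantify over types, so a condition on all walks has to name the type of
  the sample points. Paths \<open>nat \<Rightarrow> int\<close> suffice: the law of any walk is the law of a walk
  (the coordinate process) on this type. For a type that is too small, such as \<open>unit\<close>,
  no lazy walk exists and the condition would be vacuous.
\<close>

definition universal_exponent :: "nat \<Rightarrow> real \<Rightarrow> bool" where
  "universal_exponent k p \<longleftrightarrow>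
     (\<forall>(M :: (nat \<Rightarrow> int) measure) S. lazy_simple_random_walk M S \<longrightarrow> walk_estimate M S k p)"

definition critical_exponent :: "nat \<Rightarrow> real" where
  "critical_exponent k = log 2 (real ((2 * k) choose k))"

end

theory Submission
  imports Defs
begin

text \<open>
  Write \<open>a = P(X\<^sub>1 = 1)\<close> and \<open>b = P(X\<^sub>1 = -1)\<close>. Since \<open>a + b = 1/2\<close>, the step polynomial factors as
  \<open>b + z/2 + a z\<^sup>2 = (1 + z)(b + a z)\<close>, so \<open>P(S\<^sub>k = 0)\<close> is the sum of \<open>(k choose j)\<^sup>2 a\<^sup>j b\<^bsup>k-j\<^esup>\<close>.
  By homogeneity and symmetry the estimate becomes \<open>f(x) \<le> (1 + x\<^sup>q)\<^sup>p\<close> on \<open>[0,1]\<close>, where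
  \<open>f(x)\<close> is the sum of \<open>(k choose j)\<^sup>2 x\<^sup>j\<close>, \<open>p = p\<^sub>k\<close> and \<open>q = k/p\<close>. Let \<open>D\<close> be the logarithm of the left-hand
  side minus that of the right-hand side; it vanishes at 0 and 1 and, for \<open>k \<ge> 2\<close>, is negative near 0.
  With \<open>\<theta> = x d/dx\<close> one has \<open>\<theta>\<^sup>2 f = x (\<theta> - k)\<^sup>2 f\<close>, and this forces the second derivative of \<open>D\<close> in \<open>t = ln x\<close>
  at any critical point to have the sign of \<open>k sinh((2q-1)s)/sinh s - q\<close>, where \<open>s = -t/2 > 0\<close>; this is
  strictly decreasing in \<open>s\<close>. A positive maximum of \<open>D\<close> would have a negative local minimum to its left,
  contradicting the monotonicity. Optimality of \<open>p\<^sub>k\<close> is seen on the symmetric walk \<open>a = b = 1/4\<close>.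
\<close>

section \<open>Calculus: second-order conditions at extrema, and a decreasing quotient of
  \<open>sinh\<close>\<close>

text \<open>If \<open>c\<close> were positive, \<open>g\<close> would be positive just to the right
  of its zero \<open>a\<close>, and by the mean value theorem \<open>G\<close> would exceed
  \<open>G a\<close> there.\<close>

lemma second_derivative_test_max:
  fixes G g :: "real \<Rightarrow> real"
  assumes G: "\<And>t. (G has_real_derivative g t) (at t)"
    and g: "(g has_real_derivative c) (at a)"
    and d: "d > 0" and max: "\<And>t. \<bar>a - t\<bar> < d \<Longrightarrow> G t \<le> G a"
  shows "g a = 0" and "c \<le> 0"
proof -
  show ga: "g a = 0"
    using DERIV_local_max[OF G d] max by blast
  show "c \<le> 0"
  proof (rule ccontr)
    assume "\<not> c \<le> 0"
    then obtain e where e: "e > 0" "\<And>h. h > 0 \<Longrightarrow> h < e \<Longrightarrow> g a < g (a + h)"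
      using DERIV_pos_inc_right[OF g] by auto
    define b where "b = a + min d e / 2"
    have b: "a < b" "b < a + d" "b < a + e" using d e(1) by (auto simp: b_def min_def)
    obtain z where z: "a < z" "z < b" "G b - G a = (b - a) * g z"
      using MVT2[OF b(1), of G g] G by blast
    have "g a < g z" using e(2)[of "z - a"] z b by auto
    hence "G b - G a > 0" using z b ga by simp
    moreover have "G b \<le> G a" using max[of b] b by simp
    ultimately show False by simp
  qed
qed

lemma second_derivative_test_min:
  fixes G g :: "real \<Rightarrow> real"
  assumes G: "\<And>t. (G has_real_derivative g t) (at t)"
    and g: "(g has_real_derivative c) (at a)"
    and d: "d > 0" and min: "\<And>t. \<bar>a - t\<bar> < d \<Longrightarrow> G a \<le> G t"
  shows "g a = 0" and "c \<ge> 0"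
proof -
  have 1: "((\<lambda>t. - G t) has_real_derivative - g t) (at t)" for t
    by (intro DERIV_minus G)
  have 2: "((\<lambda>t. - g t) has_real_derivative - c) (at a)"
    by (intro DERIV_minus g)
  show "g a = 0" "c \<ge> 0"
    using second_derivative_test_max[OF 1 2 d] min by auto
qed

text \<open>The numerator \<open>N\<close> of the derivative vanishes at 0 and has derivative
  \<open>(\<alpha>\<^sup>2 - 1) * sinh (\<alpha> * v) * sinh v\<close>, which is negative for
  positive \<open>v\<close>. The lemma is applied with \<open>\<alpha> = 2 * q - 1\<close>.\<close>

lemma sinh_ratio_strict_decreasing:
  fixes \<alpha> s r :: real
  assumes \<alpha>: "0 < \<alpha>" "\<alpha> < 1" and s: "0 < s" "s < r"
  shows "sinh (\<alpha> * r) / sinh r < sinh (\<alpha> * s) / sinh s"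
proof (rule DERIV_neg_imp_decreasing_open[where f = "\<lambda>u. sinh (\<alpha> * u) / sinh u", OF s(2)])
  show "continuous_on {s..r} (\<lambda>u. sinh (\<alpha> * u) / sinh u)"
    using s by (intro continuous_intros) auto
next
  fix u assume u: "s < u" "u < r"
  define N where "N = (\<lambda>v. \<alpha> * cosh (\<alpha> * v) * sinh v - sinh (\<alpha> * v) * cosh v)"
  have "N u < N 0"
  proof (rule DERIV_neg_imp_decreasing_open[where f = N])
    show "0 < u" using u s by simp
    show "continuous_on {0..u} N" unfolding N_def by (intro continuous_intros)
    fix v assume v: "0 < v" "v < u"
    have "(N has_real_derivative (\<alpha>\<^sup>2 - 1) * (sinh (\<alpha> * v) * sinh v)) (at v)"
      unfolding N_def
      by (auto intro!: derivative_eq_intros simp: algebra_simps power2_eq_square)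
    moreover have "\<alpha>\<^sup>2 < 1" using \<alpha> by (simp add: power_less_one_iff)
    hence "(\<alpha>\<^sup>2 - 1) * (sinh (\<alpha> * v) * sinh v) < 0"
      using \<alpha> v by (intro mult_neg_pos mult_pos_pos) auto
    ultimately show "\<exists>y. (N has_real_derivative y) (at v) \<and> y < 0" by blast
  qed
  hence "N u < 0" by (simp add: N_def)
  moreover have "sinh u > 0" using u s by simp
  moreover have "((\<lambda>u. sinh (\<alpha> * u) / sinh u) has_real_derivative N u / (sinh u)\<^sup>2) (at u)"
    unfolding N_def using \<open>sinh u > 0\<close>
    by (auto intro!: derivative_eq_intros simp: algebra_simps power2_eq_square)
  ultimately show "\<exists>y. ((\<lambda>u. sinh (\<alpha> * u) / sinh u) has_real_derivative y) (at u) \<and> y < 0"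
    by (metis divide_neg_pos zero_less_power)
qed

section \<open>The polynomial \<open>f\<close>, its differential equation and second derivatives at
  critical points\<close>

definition binomial_square_sum :: "nat \<Rightarrow> real \<Rightarrow> real" where
  "binomial_square_sum k x = (\<Sum>j\<le>k. (real (k choose j))\<^sup>2 * x ^ j)"

text \<open>This is \<open>\<theta>\<^sup>m f\<close> at \<open>x = exp t\<close>. The convention
  \<open>0 ^ 0 = 1\<close> keeps the constant term of \<open>f\<close> when
  \<open>m = 0\<close>.\<close>

definition exp_moment :: "nat \<Rightarrow> nat \<Rightarrow> real \<Rightarrow> real" where
  "exp_moment k m t = (\<Sum>j\<le>k. real j ^ m * ((real (k choose j))\<^sup>2 * exp (real j * t)))"

lemma exp_moment_0: "exp_moment k 0 t = binomial_square_sum k (exp t)"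
  by (simp add: exp_moment_def binomial_square_sum_def exp_of_nat_mult)

lemma exp_moment_deriv:
  "((exp_moment k m) has_real_derivative exp_moment k (Suc m) t) (at t)"
  unfolding exp_moment_def[abs_def]
  by (auto intro!: derivative_eq_intros sum.cong simp: algebra_simps)

lemma binomial_square_sum_ge_1: "x \<ge> 0 \<Longrightarrow> binomial_square_sum k x \<ge> 1"
  unfolding binomial_square_sum_def
  by (subst sum.atMost_shift) (simp add: sum_nonneg)

text \<open>The equation \<open>\<theta>\<^sup>2 f = x (\<theta> - k)\<^sup>2 f\<close> comes from
  squaring the absorption identity \<open>step\<close> and shifting the summation index by
  one.\<close>

lemma exp_moment_ode:
  "exp_moment k 2 t = exp t * (exp_moment k 2 t - 2 * real k * exp_moment k 1 t + (real k)\<^sup>2 * exp_moment k 0 t)"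
proof -
  have step: "real (Suc j) * real (k choose Suc j) = real (k - j) * real (k choose j)" for j
    by (metis binomial_absorb_comp binomial_absorption of_nat_mult)
  \<comment> \<open>The added term has binomial coefficient 0, and the factor
    \<open>real j ^ 2\<close> kills the term \<open>j = 0\<close>, so the index shift leaves a sum
    over \<open>j \<le> k\<close>.\<close>
  have "exp_moment k 2 t = (\<Sum>j\<le>Suc k. real j ^ 2 * ((real (k choose j))\<^sup>2 * exp (real j * t)))"
    by (simp add: exp_moment_def)
  also have "\<dots> = (\<Sum>j\<le>k. real (Suc j) ^ 2 * ((real (k choose Suc j))\<^sup>2 * exp (real (Suc j) * t)))"
    by (subst sum.atMost_Suc_shift) simp
  also have "\<dots> = (\<Sum>j\<le>k. exp t * ((real k - real j)\<^sup>2 * ((real (k choose j))\<^sup>2 * exp (real j * t))))"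
  proof (rule sum.cong[OF refl])
    fix j assume "j \<in> {..k}"
    hence "real (Suc j) * real (k choose Suc j) = (real k - real j) * real (k choose j)"
      using step[of j] by (simp add: of_nat_diff)
    hence sq: "(real (Suc j))\<^sup>2 * (real (k choose Suc j))\<^sup>2 = (real k - real j)\<^sup>2 * (real (k choose j))\<^sup>2"
      by (metis power_mult_distrib)
    have "exp (real (Suc j) * t) = exp t * exp (real j * t)"
      by (simp add: exp_add[symmetric] algebra_simps)
    thus "(real (Suc j))\<^sup>2 * ((real (k choose Suc j))\<^sup>2 * exp (real (Suc j) * t))
        = exp t * ((real k - real j)\<^sup>2 * ((real (k choose j))\<^sup>2 * exp (real j * t)))"
      unfolding \<open>exp (real (Suc j) * t) = exp t * exp (real j * t)\<close> mult.assoc[symmetric] sq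
      by (simp only: mult_ac)
  qed
  also have "\<dots> = exp t * (exp_moment k 2 t - 2 * real k * exp_moment k 1 t + (real k)\<^sup>2 * exp_moment k 0 t)"
    by (simp add: exp_moment_def sum_distrib_left sum_subtractf[symmetric] sum.distrib[symmetric]
        algebra_simps power2_eq_square)
  finally show ?thesis .
qed

text \<open>
  Applied with \<open>x = exp t\<close>, \<open>E = exp (q * t)\<close> and \<open>f0\<close>, \<open>f1\<close>, \<open>f2\<close> the exponential moments at \<open>t\<close>,
  so that the left-hand side is the second \<open>t\<close>-derivative of \<open>ln f0 - p ln (1 + E)\<close> with \<open>p q = k\<close>.
\<close>

lemma critical_second_derivative:
  fixes f0 f1 f2 x k q E :: real
  assumes ode: "f2 = x * (f2 - 2 * k * f1 + k\<^sup>2 * f0)" and "f0 > 0" "E > 0" "x < 1"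
    and crit: "f1 / f0 = k * E / (1 + E)"
  shows "(f2 * f0 - f1 * f1) / (f0 * f0) - k * q * E / (1 + E)\<^sup>2
    = k * E / (1 + E)\<^sup>2 * (k * ((x - E\<^sup>2) / (E * (1 - x))) - q)"
proof -
  define y where "y = f1 / f0"
  have f1: "f1 = y * f0" using \<open>f0 > 0\<close> by (simp add: y_def)
  define z where "z = f2 / f0"
  have f2: "f2 = z * f0" using \<open>f0 > 0\<close> by (simp add: z_def)
  have "z * f0 = x * (z - 2 * k * y + k\<^sup>2) * f0" using ode by (simp add: f1 f2 algebra_simps)
  hence "z = x * (z - 2 * k * y + k\<^sup>2)" using \<open>f0 > 0\<close> by simp
  \<comment> \<open>Here \<open>x < 1\<close> allows solving for \<open>z\<close>; inserting
    \<open>y\<close> from \<open>crit\<close> then leaves an expression free of \<open>f0\<close>,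
    \<open>f1\<close> and \<open>f2\<close>.\<close>
  hence z: "z * (1 - x) = x * (k\<^sup>2 - 2 * k * y)" by (simp add: algebra_simps)
  have y: "y = k * E / (1 + E)" using crit by (simp add: y_def)
  have "(f2 * f0 - f1 * f1) / (f0 * f0) = z - y\<^sup>2"
    using \<open>f0 > 0\<close> by (simp add: f1 f2 field_simps power2_eq_square)
  also have "z = x * (k\<^sup>2 - 2 * k * y) / (1 - x)" using z assms by (simp add: field_simps)
  also have "x * (k\<^sup>2 - 2 * k * y) / (1 - x) - y\<^sup>2 = k\<^sup>2 * (x - E\<^sup>2) / ((1 - x) * (1 + E)\<^sup>2)"
  proof -
    have "1 - x \<noteq> 0" "1 + E \<noteq> 0" using assms by auto
    thus ?thesis unfolding y by (simp add: divide_simps) algebra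
  qed
  also have "\<dots> - k * q * E / (1 + E)\<^sup>2
    = k * E / (1 + E)\<^sup>2 * (k * ((x - E\<^sup>2) / (E * (1 - x))) - q)"
  proof -
    have "1 - x \<noteq> 0" "1 + E \<noteq> 0" "E \<noteq> 0" using assms by auto
    thus ?thesis by (simp add: divide_simps) algebra
  qed
  finally show ?thesis .
qed

text \<open>With \<open>u = exp (- s)\<close> one has \<open>x = u\<^sup>2\<close>, and the two
  exponentials in the numerator are \<open>u / E\<close> and \<open>E / u\<close>. This identifies
  the fraction of \<open>critical_second_derivative\<close> at \<open>t = - 2 * s\<close>.\<close>

lemma sinh_ratio_eq:
  fixes q s :: real
  assumes "s > 0"
  defines "x \<equiv> exp (- 2 * s)" and "E \<equiv> exp (q * (- 2 * s))"
  shows "(x - E\<^sup>2) / (E * (1 - x)) = sinh ((2 * q - 1) * s) / sinh s"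
proof -
  define u where "u = exp (- s)"
  have u: "0 < u" "u < 1" using assms by (auto simp: u_def)
  have E: "E > 0" by (simp add: E_def)
  have x: "x = u\<^sup>2" by (simp add: x_def u_def exp_double[symmetric])
  have "exp ((2 * q - 1) * s) = u / E"
    by (simp add: u_def E_def exp_diff[symmetric] algebra_simps)
  moreover have "exp (- ((2 * q - 1) * s)) = E / u"
    by (simp add: u_def E_def exp_diff[symmetric] algebra_simps)
  ultimately have 1: "sinh ((2 * q - 1) * s) = (u / E - E / u) / 2"
    by (simp add: sinh_field_def)
  have 2: "sinh s = (1 / u - u) / 2"
    by (simp add: sinh_field_def u_def exp_minus field_simps)
  have "1 - u\<^sup>2 \<noteq> 0" using u by (simp add: power_less_one_iff less_imp_neq[symmetric])
  thus ?thesis unfolding 1 2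
    using u E by (simp add: x divide_simps) algebra
qed

section \<open>Size of the central binomial coefficient and bounds on \<open>f\<close>\<close>

text \<open>Row \<open>2 * k\<close> of the binomial triangle sums to \<open>2 ^ (2 * k)\<close> and
  contains a further entry 1 at \<open>j = 0\<close>. The bound yields \<open>p < 2 * k\<close>,
  hence \<open>q > 1 / 2\<close>.\<close>

lemma central_binomial_less:
  assumes "k > 0" shows "real ((2 * k) choose k) < 2 powr (2 * real k)"
proof -
  have "(2 * k choose k) + (2 * k choose 0) = (\<Sum>j\<in>{k, 0}. 2 * k choose j)"
    using assms by simp
  also have "\<dots> \<le> (\<Sum>j\<le>2 * k. 2 * k choose j)"
    by (intro sum_mono2) auto
  also have "\<dots> = 2 ^ (2 * k)" by (rule choose_row_sum)
  finally have "real ((2 * k) choose k) < 2 ^ (2 * k)"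
    by (metis Suc_eq_plus1 Suc_le_lessD binomial_n_0 of_nat_less_numeral_power_cancel_iff)
  thus ?thesis by (simp add: powr_realpow[symmetric])
qed

text \<open>Squaring the entries of row \<open>k\<close> strictly enlarges the entry at
  \<open>j = 1\<close>, which is \<open>k\<close>. The bound yields \<open>p > k\<close>, hence
  \<open>q < 1\<close>; for \<open>k = 1\<close> there is equality.\<close>

lemma central_binomial_greater:
  assumes "k \<ge> 2" shows "2 powr real k < real ((2 * k) choose k)"
proof -
  have "2 ^ k = (\<Sum>j\<le>k. k choose j)" by (rule choose_row_sum[symmetric])
  also have "\<dots> < (\<Sum>j\<le>k. (k choose j)\<^sup>2)"
  proof (rule sum_strict_mono_ex1)
    show "\<forall>j\<in>{..k}. k choose j \<le> (k choose j)\<^sup>2"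
      by (simp add: power2_nat_le_imp_le self_le_power Suc_leI)
    show "\<exists>j\<in>{..k}. k choose j < (k choose j)\<^sup>2"
      using assms by (intro bexI[of _ 1]) (auto simp: power2_eq_square)
  qed simp
  also have "\<dots> = (2 * k) choose k" by (rule choose_square_sum)
  finally show ?thesis
    by (simp add: powr_realpow of_nat_less_numeral_power_cancel_iff numeral_power_less_of_nat_cancel_iff)
qed

lemma binomial_square_sum_1: "binomial_square_sum k 1 = real ((2 * k) choose k)"
  by (simp add: binomial_square_sum_def choose_square_sum[symmetric])

text \<open>Every power \<open>x ^ j\<close> with \<open>j \<ge> 1\<close> is at most
  \<open>x\<close> on the unit interval. The bound shows that \<open>f - 1\<close> grows at most
  linearly near 0, more slowly than \<open>x powr q\<close>.\<close>

lemma binomial_square_sum_le_affine: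
  assumes "0 \<le> x" "x \<le> 1"
  shows "binomial_square_sum k x \<le> 1 + (real ((2 * k) choose k) - 1) * x"
proof -
  have eq: "binomial_square_sum k y = 1 + (\<Sum>j<k. (real (k choose Suc j))\<^sup>2 * y ^ Suc j)" for y
    unfolding binomial_square_sum_def by (subst sum.atMost_shift) simp
  have "(\<Sum>j<k. (real (k choose Suc j))\<^sup>2 * x ^ Suc j) \<le> (\<Sum>j<k. (real (k choose Suc j))\<^sup>2 * x)"
    using assms by (intro sum_mono mult_left_mono) (auto simp: mult_left_le power_le_one)
  also have "\<dots> = (binomial_square_sum k 1 - 1) * x"
    by (simp add: eq sum_distrib_right)
  finally show ?thesis by (simp add: eq[of x] binomial_square_sum_1)
qed

section \<open>The one-variable inequality\<close>

lemma two_point_inequality: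
  fixes p q x :: real
  assumes k: "k \<ge> 2" and p: "2 powr p = real ((2 * k) choose k)" and q: "q = k / p"
    and x: "0 \<le> x" "x \<le> 1"
  shows "binomial_square_sum k x \<le> (1 + x powr q) powr p"
proof -
  define C where "C = real ((2 * k) choose k)"
  have "2 powr real k < 2 powr p" "2 powr p < 2 powr (2 * real k)"
    using central_binomial_greater[OF k] central_binomial_less[of k] k p by auto
  hence pk: "real k < p" "p < 2 * real k" by auto
  have p0: "p > 0" using pk k by linarith
  have q12: "0 < q" "q < 1" "0 < 2 * q - 1" "2 * q - 1 < 1"
    using pk k p0 by (auto simp: q field_simps)
  have pq: "p * q = k" using p0 by (simp add: q)
  have C1: "C > 1" using central_binomial_greater[OF k] k
    by (smt (verit) C_def ge_one_powr_ge_zero of_nat_0_le_iff)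
  define D where "D = (\<lambda>y. ln (binomial_square_sum k y) - p * ln (1 + y powr q))"
  have D0: "D 0 = 0"
    using binomial_square_sum_le_affine[of 0 k] binomial_square_sum_ge_1[of 0 k] by (simp add: D_def)
  have D1: "D 1 = 0"
    using p by (simp add: D_def binomial_square_sum_1 ln_powr flip: p)
  have pos: "binomial_square_sum k y > 0" if "y \<ge> 0" for y
    using binomial_square_sum_ge_1[OF that, of k] by linarith
  have cont: "continuous_on {0..1} D"
  proof -
    have "continuous_on {0..1} (binomial_square_sum k)"
      unfolding binomial_square_sum_def[abs_def] by (intro continuous_intros)
    \<comment> \<open>Continuity at 0 rests on \<open>0 powr q = 0\<close> together with
      \<open>q > 0\<close>.\<close>
    moreover have "continuous_on {0..1} (\<lambda>y::real. y powr q)"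
      using q12 by (intro continuous_on_powr' continuous_intros) auto
    moreover have "\<forall>y\<in>{0..1}. binomial_square_sum k y \<noteq> 0"
      using pos by (metis atLeastAtMost_iff less_irrefl)
    moreover have "\<forall>y\<in>{0..1}. 1 + y powr q \<noteq> 0"
      by (metis add_pos_nonneg less_irrefl powr_ge_zero zero_less_one)
    ultimately show ?thesis
      unfolding D_def by (intro continuous_on_diff continuous_on_mult continuous_on_ln continuous_on_add continuous_on_const)
  qed
  have neg: "\<exists>y. 0 < y \<and> y < r \<and> D y < 0" if "0 < r" "r \<le> 1" for r
  proof -
    \<comment> \<open>The value is chosen so that \<open>y powr (1 - q) < e\<close> says
      \<open>(C - 1) * y < p * (y powr q / 2)\<close>. The left side bounds \<open>ln (f y)\<close>
      from above, the right side bounds \<open>p * ln (1 + y powr q)\<close> from below.\<close>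
    define e where "e = p / (2 * (C - 1))"
    have e: "e > 0" using p0 C1 by (simp add: e_def)
    define y where "y = min r (e powr (1 / (1 - q))) / 2"
    have y: "0 < y" "y < r" "y < e powr (1 / (1 - q))"
      using that e by (auto simp: y_def min_def)
    have "y powr (1 - q) < (e powr (1 / (1 - q))) powr (1 - q)"
      using y q12 by (intro powr_less_mono2) auto
    hence "y powr (1 - q) < e" using q12 e by (simp add: powr_powr)
    hence "y powr q * y powr (1 - q) < y powr q * e" using y by simp
    hence "y < y powr q * e" using y by (simp add: powr_add[symmetric])
    hence *: "(C - 1) * y < p * (y powr q / 2)" using C1 by (simp add: e_def field_simps)
    have yq: "0 < y powr q" "y powr q \<le> 1" using y that q12 by (auto intro: powr_le1)
    have "ln (binomial_square_sum k y) \<le> ln (1 + (C - 1) * y)"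
      using binomial_square_sum_le_affine[of y k] y that pos[of y] by (simp add: C_def)
    also have "\<dots> \<le> (C - 1) * y" using C1 y by (intro ln_add_one_self_le_self) auto
    also note *
    also have "p * (y powr q / 2) \<le> p * ln (1 + y powr q)"
    proof (rule mult_left_mono)
      have "v / 2 \<le> ln (1 + v)" if "0 < v" "v \<le> 1" for v :: real
      proof -
        have "ln (1 / (1 + v)) \<le> 1 / (1 + v) - 1" using that by (intro ln_le_minus_one) simp
        moreover have "v / 2 \<le> v / (1 + v)" using that by (intro divide_left_mono) auto
        moreover have "v / (1 + v) = 1 - 1 / (1 + v)" using that by (simp add: field_simps)
        ultimately show ?thesis using that by (simp add: ln_div)
      qed
      thus "y powr q / 2 \<le> ln (1 + y powr q)" using yq by blast
    qed (use p0 in simp)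
    finally have "ln (binomial_square_sum k y) < p * ln (1 + y powr q)" .
    thus ?thesis using y by (intro exI[of _ y]) (simp add: D_def)
  qed
  define \<Phi> where "\<Phi> = (\<lambda>s. sinh ((2 * q - 1) * s) / sinh s)"
  \<comment> \<open>In the variable \<open>t = ln x\<close>, \<open>g\<close> and \<open>h\<close>
    are the first and second derivatives of \<open>G\<close>, with \<open>p * q\<close> written as
    \<open>k\<close>.\<close>
  define G where "G = (\<lambda>t. D (exp t))"
  define g where "g = (\<lambda>t. exp_moment k 1 t / exp_moment k 0 t - k * exp (q * t) / (1 + exp (q * t)))"
  define h where "h = (\<lambda>t. (exp_moment k 2 t * exp_moment k 0 t - exp_moment k 1 t * exp_moment k 1 t)
      / (exp_moment k 0 t * exp_moment k 0 t) - k * q * exp (q * t) / (1 + exp (q * t))\<^sup>2)"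
  have S0: "exp_moment k 0 t > 0" for t using pos by (simp add: exp_moment_0)
  have E1: "1 + exp (q * t) > 0" "1 + exp (q * t) \<noteq> 0" for t
    by (simp_all add: add_pos_pos less_imp_neq[symmetric])
  have G: "(G has_real_derivative g t) (at t)" for t
  proof -
    have "G = (\<lambda>t. ln (exp_moment k 0 t) - p * ln (1 + exp (q * t)))"
      by (simp add: G_def D_def exp_moment_0 exp_powr_real mult.commute)
    thus ?thesis unfolding g_def pq[symmetric]
      using S0[of t] E1[of t]
      by (auto intro!: derivative_eq_intros exp_moment_deriv simp: field_simps)
  qed
  have g: "(g has_real_derivative h t) (at t)" for t
    unfolding g_def h_def
  proof (rule DERIV_diff)
    show "((\<lambda>t. exp_moment k 1 t / exp_moment k 0 t) has_real_derivative
        (exp_moment k 2 t * exp_moment k 0 t - exp_moment k 1 t * exp_moment k 1 t)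
          / (exp_moment k 0 t * exp_moment k 0 t)) (at t)"
      using DERIV_divide[OF exp_moment_deriv[of k 1 t] exp_moment_deriv[of k 0 t]] S0[of t]
      by (simp add: numeral_2_eq_2)
    have "((\<lambda>t. k * exp (q * t) / (1 + exp (q * t))) has_real_derivative
        (k * (exp (q * t) * q) * (1 + exp (q * t)) - k * exp (q * t) * (exp (q * t) * q))
          / ((1 + exp (q * t)) * (1 + exp (q * t)))) (at t)"
      using E1[of t] by (auto intro!: derivative_eq_intros)
    moreover have "k * (exp (q * t) * q) * (1 + exp (q * t)) - k * exp (q * t) * (exp (q * t) * q)
      = k * q * exp (q * t)"
      by (simp add: algebra_simps)
    ultimately show "((\<lambda>t. k * exp (q * t) / (1 + exp (q * t))) has_real_derivative
        k * q * exp (q * t) / (1 + exp (q * t))\<^sup>2) (at t)"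
      by (simp only: power2_eq_square)
  qed
  have h: "\<exists>c>0. h t = c * (k * \<Phi> (- t / 2) - q)" if "t < 0" "g t = 0" for t
  proof (intro exI conjI)
    show "k * exp (q * t) / (1 + exp (q * t))\<^sup>2 > 0" using k E1 by simp
    show "h t = k * exp (q * t) / (1 + exp (q * t))\<^sup>2 * (k * \<Phi> (- t / 2) - q)"
    proof -
      have "\<Phi> (- t / 2) = (exp t - (exp (q * t))\<^sup>2) / (exp (q * t) * (1 - exp t))"
        using sinh_ratio_eq[of "- t / 2" q] that unfolding \<Phi>_def by simp
      moreover have "exp_moment k 1 t / exp_moment k 0 t = k * exp (q * t) / (1 + exp (q * t))"
        using that by (simp add: g_def)
      ultimately show ?thesis
        using critical_second_derivative[where E = "exp (q * t)" and q = q,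
            OF exp_moment_ode[of k t] S0[of t]] that
        by (simp only: h_def exp_gt_zero exp_less_one_iff)
    qed
  qed
  have "D x \<le> 0"
  proof (rule ccontr)
    assume "\<not> D x \<le> 0"
    obtain a where a: "a \<in> {0..1}" "\<And>y. y \<in> {0..1} \<Longrightarrow> D y \<le> D a"
      using continuous_attains_sup[OF _ _ cont] by auto
    have Da: "D a > 0" using a(2)[of x] x \<open>\<not> D x \<le> 0\<close> by simp
    have "a \<noteq> 0" "a \<noteq> 1" using Da D0 D1 by auto
    hence a01: "0 < a" "a < 1" using a(1) by auto
    have "continuous_on {0..a} D"
      using a01 by (intro continuous_on_subset[OF cont]) auto
    \<comment> \<open>Minimising only over \<open>{0..a}\<close> puts the minimum to the left of the
      maximum. By \<open>neg\<close> with \<open>r = a\<close> the minimal value is negative, which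
      excludes both endpoints.\<close>
    then obtain b where b: "b \<in> {0..a}" "\<And>y. y \<in> {0..a} \<Longrightarrow> D b \<le> D y"
      using continuous_attains_inf[of "{0..a}" D] a01 by auto
    obtain y where y: "0 < y" "y < a" "D y < 0" using neg[of a] a01 by auto
    have Db: "D b < 0" using b(2)[of y] y by simp
    have "b \<noteq> 0" "b \<noteq> a" using Da Db D0 by auto
    hence b0: "0 < b" "b < a" using b(1) by auto
    define s t where "s = ln a" and "t = ln b"
    have st: "t < s" "s < 0" "exp s = a" "exp t = b" using a01 b0 by (auto simp: s_def t_def)
    \<comment> \<open>The radius \<open>- s\<close> keeps \<open>exp u\<close> below 1; in the next
      claim the radius \<open>s - t\<close> keeps \<open>exp u\<close> below
      \<open>a\<close>.\<close>
    have max: "G u \<le> G s" if "\<bar>s - u\<bar> < - s" for u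
      using a(2)[of "exp u"] that st by (simp add: G_def)
    have min: "G t \<le> G u" if "\<bar>t - u\<bar> < s - t" for u
    proof -
      have "exp u \<le> exp s" using that by simp
      thus ?thesis using b(2)[of "exp u"] st by (simp add: G_def)
    qed
    have s: "g s = 0" "h s \<le> 0"
      using second_derivative_test_max[OF G g[of s], of "- s"] max st by auto
    have t: "g t = 0" "h t \<ge> 0"
      using second_derivative_test_min[OF G g[of t], of "s - t"] min st by auto
    \<comment> \<open>The maximum at \<open>s\<close> and the minimum at \<open>t\<close> give
      \<open>\<Phi> (- s / 2) \<le> q / k \<le> \<Phi> (- t / 2)\<close>, although
      \<open>- t / 2\<close> is the larger argument of a strictly decreasing function.\<close>
    have "k * \<Phi> (- s / 2) - q \<le> 0"
      using h[of s] s st by (auto simp: mult_le_0_iff)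
    moreover have "k * \<Phi> (- t / 2) - q \<ge> 0"
      using h[of t] t st by (auto simp: zero_le_mult_iff)
    moreover have "\<Phi> (- t / 2) < \<Phi> (- s / 2)"
      unfolding \<Phi>_def using st q12 by (intro sinh_ratio_strict_decreasing) auto
    hence "k * \<Phi> (- t / 2) < k * \<Phi> (- s / 2)" using k by simp
    ultimately show False by linarith
  qed
  hence "ln (binomial_square_sum k x) \<le> ln ((1 + x powr q) powr p)"
    by (simp add: D_def ln_powr)
  moreover have "0 < (1 + x powr q) powr p"
    by (metis add_pos_nonneg less_irrefl powr_ge_zero powr_gt_zero zero_less_one)
  ultimately show ?thesis using ln_le_cancel_iff pos[OF x(1)] by blast
qed

lemma powr_critical_exponent: "2 powr critical_exponent k = real ((2 * k) choose k)"
  unfolding critical_exponent_def by (simp add: zero_less_binomial_iff)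

lemma critical_exponent_pos:
  assumes "k > 0" shows "critical_exponent k > 0"
proof -
  have "real ((2 * k) choose k) > 1"
  proof (cases "k = 1")
    case False
    with assms have "k \<ge> 2" by simp
    moreover have "1 \<le> 2 powr real k" by (simp add: ge_one_powr_ge_zero)
    ultimately show ?thesis using central_binomial_greater[of k] by linarith
  qed simp
  thus ?thesis by (simp add: critical_exponent_def)
qed

text \<open>For \<open>k = 1\<close> the exponent is 1 and both sides equal \<open>1 + x\<close>;
  for larger \<open>k\<close> this is the \<open>p\<close>-th root of
  \<open>two_point_inequality\<close>.\<close>

lemma binomial_square_sum_le:
  assumes k: "k > 0" and x: "0 \<le> x" "x \<le> 1"
  shows "binomial_square_sum k x powr (1 / critical_exponent k)
    \<le> 1 + x powr (k / critical_exponent k)"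
proof -
  define p where "p = critical_exponent k"
  have p: "p > 0" "2 powr p = real ((2 * k) choose k)"
    using critical_exponent_pos[OF k] powr_critical_exponent by (simp_all add: p_def)
  show ?thesis
  proof (cases "k = 1")
    case True
    have "critical_exponent (Suc 0) = 1" by (simp add: critical_exponent_def)
    thus ?thesis using True x by (simp add: binomial_square_sum_def)
  next
    case False
    with k have "k \<ge> 2" by simp
    have "binomial_square_sum k x powr (1 / p) \<le> ((1 + x powr (k / p)) powr p) powr (1 / p)"
      using two_point_inequality[OF \<open>k \<ge> 2\<close> p(2) refl x] p binomial_square_sum_ge_1[OF x(1), of k]
      by (intro powr_mono2) auto
    also have "\<dots> = 1 + x powr (k / p)"
      using p by (simp add: powr_powr add_pos_nonneg)
    finally show ?thesis by (simp add: p_def)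
  qed
qed

section \<open>The homogeneous inequality in two variables\<close>

text \<open>Both sides scale alike in \<open>(a, b)\<close>, so dividing by the larger variable
  leads to the unit interval. Reversing the summation index exchanges \<open>a\<close> and
  \<open>b\<close>.\<close>

lemma homogeneous_inequality:
  fixes a b :: real
  assumes k: "k > 0" and ab: "0 \<le> a" "0 \<le> b"
  defines "r \<equiv> 1 / critical_exponent k"
  shows "(\<Sum>j\<le>k. (real (k choose j))\<^sup>2 * a ^ j * b ^ (k - j)) powr r
    \<le> (a ^ k) powr r + (b ^ k) powr r"
proof -
  have *: "(\<Sum>j\<le>k. (real (k choose j))\<^sup>2 * a ^ j * b ^ (k - j)) powr r
      \<le> (a ^ k) powr r + (b ^ k) powr r" if "0 \<le> a" "a \<le> b" for a b :: real
  proof (cases "b = 0")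
    \<comment> \<open>Here \<open>a\<close> is 0 as well; since \<open>k > 0\<close> every summand
      vanishes, and \<open>0 powr r = 0\<close>.\<close>
    case True
    hence "(\<Sum>j\<le>k. (real (k choose j))\<^sup>2 * a ^ j * b ^ (k - j)) = 0"
      using k that by (intro sum.neutral) (auto simp: power_0_left)
    thus ?thesis by simp
  next
    case False
    hence b: "b > 0" using that by simp
    define x where "x = a / b"
    have x: "0 \<le> x" "x \<le> 1" "a = x * b" using b that by (auto simp: x_def field_simps)
    have "(\<Sum>j\<le>k. (real (k choose j))\<^sup>2 * a ^ j * b ^ (k - j)) = binomial_square_sum k x * b ^ k"
      unfolding binomial_square_sum_def sum_distrib_right
      by (intro sum.cong refl) (simp add: x(3) power_mult_distrib mult_ac flip: power_add)
    also have "\<dots> powr r = binomial_square_sum k x powr r * (b ^ k) powr r"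
      using binomial_square_sum_ge_1[OF x(1), of k] b by (intro powr_mult)
    also have "\<dots> \<le> (1 + x powr (k / critical_exponent k)) * (b ^ k) powr r"
      using binomial_square_sum_le[OF k x(1,2)] by (intro mult_right_mono) (auto simp: r_def)
    also have "x powr (k / critical_exponent k) = (x ^ k) powr r"
      using x(1) k by (cases "x = 0") (auto simp: r_def powr_powr simp flip: powr_realpow)
    also have "(1 + (x ^ k) powr r) * (b ^ k) powr r = (a ^ k) powr r + (b ^ k) powr r"
      using x b by (simp add: algebra_simps power_mult_distrib powr_mult)
    finally show ?thesis .
  qed
  show ?thesis
  proof (cases "a \<le> b")
    case True thus ?thesis using *[of a b] ab by simp
  next
    case False
    have "(\<Sum>j\<le>k. (real (k choose j))\<^sup>2 * a ^ j * b ^ (k - j))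
        = (\<Sum>j\<le>k. (real (k choose j))\<^sup>2 * b ^ j * a ^ (k - j))"
      by (rule sum.reindex_bij_witness[of _ "\<lambda>j. k - j" "\<lambda>j. k - j"])
         (auto simp: binomial_symmetric[symmetric] mult_ac)
    thus ?thesis using *[of b a] ab False by simp
  qed
qed

section \<open>The law of the walk by generating functions\<close>

text \<open>Resting with probability exactly 1/2 makes -1 a root of the step polynomial.\<close>

lemma lazy_walk_step_polynomial:
  fixes a b :: real
  assumes "a + b = 1 / 2"
  shows "[:b, 1 / 2, a:] = [:1, 1:] * [:b, a:]"
  using assms by (simp add: add.commute)

text \<open>In the product of \<open>[:1, 1:] ^ n\<close> and \<open>[:b, a:] ^ n\<close>, each
  factor contributes a binomial coefficient to the middle coefficient; by symmetry the two coincide,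
  which produces the squares.\<close>

lemma coeff_step_polynomial_power:
  fixes a b :: real
  assumes "a + b = 1 / 2"
  shows "coeff ([:b, 1 / 2, a:] ^ n) 0 = b ^ n"
    and "coeff ([:b, 1 / 2, a:] ^ n) (2 * n) = a ^ n"
    and "coeff ([:b, 1 / 2, a:] ^ n) n = (\<Sum>j\<le>n. (real (n choose j))\<^sup>2 * a ^ j * b ^ (n - j))"
proof -
  have W: "[:b, 1 / 2, a:] ^ n = [:1, 1:] ^ n * [:b, a:] ^ n"
    unfolding lazy_walk_step_polynomial[OF assms] by (rule power_mult_distrib)
  show "coeff ([:b, 1 / 2, a:] ^ n) 0 = b ^ n"
    by (simp add: coeff_0_power)
  \<comment> \<open>An upper bound suits the degenerate case \<open>a = 0\<close> too; it leaves
    only \<open>i = n\<close> in the convolution for the top coefficient.\<close>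
  have deg: "degree ([:c, d:] ^ n) \<le> n" for c d :: real
    by (rule order_trans[OF degree_power_le]) simp
  have "coeff ([:b, 1 / 2, a:] ^ n) (n + n) = coeff ([:1, 1:] ^ n) n * coeff ([:b, a:] ^ n) n"
    unfolding W coeff_mult
  proof (subst sum.mono_neutral_right[of _ "{n}"])
    show "\<forall>i\<in>{..n + n} - {n}. coeff ([:1, 1:] ^ n) i * coeff ([:b, a:] ^ n) (n + n - i) = 0"
    proof
      fix i assume "i \<in> {..n + n} - {n}"
      hence "i > n \<or> n + n - i > n" by auto
      thus "coeff ([:1, 1:] ^ n) i * coeff ([:b, a:] ^ n) (n + n - i) = 0"
        using coeff_eq_0[OF le_less_trans[OF deg]] by auto
    qed
  qed auto
  thus "coeff ([:b, 1 / 2, a:] ^ n) (2 * n) = a ^ n"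
    by (simp add: coeff_linear_poly_power mult_2)
  have "coeff ([:b, 1 / 2, a:] ^ n) n = (\<Sum>j\<le>n. coeff ([:b, a:] ^ n) j * coeff ([:1, 1:] ^ n) (n - j))"
    unfolding W by (subst mult.commute) (rule coeff_mult)
  also have "\<dots> = (\<Sum>j\<le>n. (real (n choose j))\<^sup>2 * a ^ j * b ^ (n - j))"
    by (intro sum.cong refl)
       (simp add: coeff_linear_poly_power binomial_symmetric[symmetric] power2_eq_square)
  finally show "coeff ([:b, 1 / 2, a:] ^ n) n = \<dots>" .
qed

text \<open>By independence the generating function of \<open>S n + n\<close> is the
  \<open>n\<close>-th power of the step polynomial, so the probabilities are its
  coefficients.\<close>

lemma lazy_walk_probabilities:
  assumes "lazy_simple_random_walk M S"
  defines "a \<equiv> \<P>(\<omega> in M. S 1 \<omega> = 1)" and "b \<equiv> \<P>(\<omega> in M. S 1 \<omega> = - 1)"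
  shows "a + b = 1 / 2"
    and "\<P>(\<omega> in M. S n \<omega> = int n) = a ^ n"
    and "\<P>(\<omega> in M. S n \<omega> = - int n) = b ^ n"
    and "\<P>(\<omega> in M. S n \<omega> = 0) = (\<Sum>j\<le>n. (real (n choose j))\<^sup>2 * a ^ j * b ^ (n - j))"
proof -
  from assms(1) obtain X :: "nat \<Rightarrow> _ \<Rightarrow> int" where "prob_space M"
    and indep: "prob_space.indep_vars M (\<lambda>_. count_space UNIV) X {1..}"
    and ident: "\<And>i. i \<ge> 1 \<Longrightarrow> distr M (count_space UNIV) (X i) = distr M (count_space UNIV) (X 1)"
    and range: "\<And>i \<omega>. i \<ge> 1 \<Longrightarrow> \<omega> \<in> space M \<Longrightarrow> X i \<omega> \<in> {-1, 0, 1}"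
    and half: "\<P>(\<omega> in M. X 1 \<omega> = 0) = 1 / 2"
    and S: "\<And>n \<omega>. \<omega> \<in> space M \<Longrightarrow> S n \<omega> = (\<Sum>i=1..n. X i \<omega>)"
    unfolding lazy_simple_random_walk_def by blast
  interpret prob_space M by fact
  have X [measurable]: "X i \<in> M \<rightarrow>\<^sub>M count_space UNIV" if "i \<ge> 1" for i
    using indep that unfolding indep_vars_def by auto
  have X1 [measurable]: "X 1 \<in> M \<rightarrow>\<^sub>M count_space UNIV" by (rule X) simp
  have a: "a = \<P>(\<omega> in M. X 1 \<omega> = 1)" and b: "b = \<P>(\<omega> in M. X 1 \<omega> = - 1)"
    unfolding a_def b_def using S[of _ 1] by (auto intro!: arg_cong[where f = prob])
  \<comment> \<open>Shifting each step by 1 gives values in 0, 1, 2, so that the generating function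
    is a polynomial; the event \<open>S n = m\<close> becomes \<open>T = m + n\<close>.\<close>
  define Y where "Y = (\<lambda>i \<omega>. nat (X i \<omega> + 1))"
  have int: "integrable M (indicator {\<omega>\<in>space M. X 1 \<omega> = m} :: _ \<Rightarrow> real)" for m
    by (intro integrable_real_indicator) (auto simp: emeasure_eq_measure)
  have EY: "expectation (\<lambda>\<omega>. z ^ Y i \<omega>) = b + z / 2 + a * z\<^sup>2" if "i \<ge> 1" for i and z :: real
  proof -
    have "expectation (\<lambda>\<omega>. z ^ Y i \<omega>) = integral\<^sup>L (distr M (count_space UNIV) (X i)) (\<lambda>x. z ^ nat (x + 1))"
      unfolding Y_def using that by (subst integral_distr) auto
    also have "\<dots> = expectation (\<lambda>\<omega>. z ^ Y 1 \<omega>)"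
      unfolding ident[OF that] Y_def by (subst integral_distr) auto
    also have "\<dots> = expectation (\<lambda>\<omega>. indicator {\<omega>\<in>space M. X 1 \<omega> = - 1} \<omega>
        + z * indicator {\<omega>\<in>space M. X 1 \<omega> = 0} \<omega> + z\<^sup>2 * indicator {\<omega>\<in>space M. X 1 \<omega> = 1} \<omega>)"
      using range[of 1] by (intro Bochner_Integration.integral_cong refl)
        (fastforce simp: Y_def indicator_def)
    also have "\<dots> = b + z / 2 + a * z\<^sup>2"
      using int by (simp add: a b half del: One_nat_def)
    finally show ?thesis .
  qed
  \<comment> \<open>Evaluating the generating function at \<open>z = 1\<close> expresses that the
    total mass is 1.\<close>
  show ab: "a + b = 1 / 2"
    using EY[of 1 1] prob_space by simp
  define T where "T = (\<lambda>\<omega>. \<Sum>i=1..n. Y i \<omega>)"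
  have Ymeas: "Y i \<in> M \<rightarrow>\<^sub>M count_space UNIV" if "i \<ge> 1" for i
    unfolding Y_def using X[OF that] by measurable
  have T [measurable]: "T \<in> M \<rightarrow>\<^sub>M count_space UNIV"
    unfolding T_def by (intro measurable_sum_nat Ymeas) auto
  have TS: "int (T \<omega>) = S n \<omega> + int n" if "\<omega> \<in> space M" for \<omega>
  proof -
    have "int (T \<omega>) = (\<Sum>i=1..n. X i \<omega> + 1)"
      unfolding T_def Y_def of_nat_sum using range[OF _ that] by (intro sum.cong refl) fastforce
    thus ?thesis using S[OF that] by (simp add: sum.distrib)
  qed
  have T_le: "T \<omega> \<le> 2 * n" if "\<omega> \<in> space M" for \<omega>
  proof -
    have "T \<omega> \<le> (\<Sum>i=1..n. 2)"
      unfolding T_def Y_def using range[OF _ that] by (intro sum_mono) fastforce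
    thus ?thesis by simp
  qed
  define P where "P = (\<Sum>j\<le>2 * n. monom (\<P>(\<omega> in M. T \<omega> = j)) j)"
  \<comment> \<open>Real polynomials that agree as functions have equal coefficients, so it suffices
    to compare values at every real \<open>z\<close>.\<close>
  have "poly P = poly ([:b, 1 / 2, a:] ^ n)"
  proof
    fix z
    have "poly P z = (\<Sum>j\<le>2 * n. expectation (\<lambda>\<omega>. z ^ j * indicator {\<omega>\<in>space M. T \<omega> = j} \<omega>))"
      by (simp add: P_def poly_sum poly_monom mult.commute)
    also have "\<dots> = expectation (\<lambda>\<omega>. \<Sum>j\<le>2 * n. z ^ j * indicator {\<omega>\<in>space M. T \<omega> = j} \<omega>)"
      by (intro Bochner_Integration.integral_sum[symmetric] integrable_mult_right integrable_real_indicator)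
        (auto simp: emeasure_eq_measure)
    also have "\<dots> = expectation (\<lambda>\<omega>. z ^ T \<omega>)"
    proof (intro Bochner_Integration.integral_cong refl)
      fix \<omega> assume "\<omega> \<in> space M"
      hence "(\<Sum>j\<le>2 * n. z ^ j * indicator {\<omega>\<in>space M. T \<omega> = j} \<omega>) = (\<Sum>j\<le>2 * n. if j = T \<omega> then z ^ j else 0)"
        by (intro sum.cong) auto
      thus "(\<Sum>j\<le>2 * n. z ^ j * indicator {\<omega>\<in>space M. T \<omega> = j} \<omega>) = z ^ T \<omega>"
        using T_le[OF \<open>\<omega> \<in> space M\<close>] by simp
    qed
    also have "\<dots> = expectation (\<lambda>\<omega>. \<Prod>i=1..n. z ^ Y i \<omega>)"
      by (simp add: T_def power_sum)
    also have "\<dots> = (\<Prod>i=1..n. expectation (\<lambda>\<omega>. z ^ Y i \<omega>))"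
    proof (rule indep_vars_lebesgue_integral)
      show "indep_vars (\<lambda>_. borel) (\<lambda>i \<omega>. z ^ Y i \<omega>) {1..n}"
        unfolding Y_def
        by (rule indep_vars_compose2[where Y = "\<lambda>_ x. z ^ nat (x + 1)",
              OF indep_vars_subset[OF indep]]) auto
      fix i assume i: "i \<in> {1..n}"
      have [measurable]: "Y i \<in> M \<rightarrow>\<^sub>M count_space UNIV" using i by (intro Ymeas) simp
      have "norm (z ^ Y i \<omega>) \<le> 1 + \<bar>z\<bar> + z\<^sup>2" if "\<omega> \<in> space M" for \<omega>
        using range[OF _ that, of i] i by (auto simp: Y_def)
      thus "integrable M (\<lambda>\<omega>. z ^ Y i \<omega>)"
        by (intro integrable_const_bound[where B = "1 + \<bar>z\<bar> + z\<^sup>2"]) auto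
    qed simp
    also have "\<dots> = poly ([:b, 1 / 2, a:] ^ n) z"
      by (simp add: EY poly_power power2_eq_square algebra_simps)
    finally show "poly P z = poly ([:b, 1 / 2, a:] ^ n) z" .
  qed
  hence "P = [:b, 1 / 2, a:] ^ n" by (simp add: poly_eq_poly_eq_iff)
  moreover have "coeff P j = \<P>(\<omega> in M. T \<omega> = j)" if "j \<le> 2 * n" for j
    using that by (simp add: P_def coeff_sum)
  ultimately have *: "\<P>(\<omega> in M. T \<omega> = j) = coeff ([:b, 1 / 2, a:] ^ n) j" if "j \<le> 2 * n" for j
    using that by simp
  have **: "\<P>(\<omega> in M. S n \<omega> = m) = coeff ([:b, 1 / 2, a:] ^ n) j"
    if "int j = m + int n" "j \<le> 2 * n" for m j
  proof -
    have "\<P>(\<omega> in M. S n \<omega> = m) = \<P>(\<omega> in M. T \<omega> = j)"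
      using TS that by (intro arg_cong[where f = prob]) force
    thus ?thesis using *[OF that(2)] by simp
  qed
  show "\<P>(\<omega> in M. S n \<omega> = int n) = a ^ n"
    using **[of "2 * n" "int n"] coeff_step_polynomial_power(2)[OF ab] by simp
  show "\<P>(\<omega> in M. S n \<omega> = - int n) = b ^ n"
    using **[of 0 "- int n"] coeff_step_polynomial_power(1)[OF ab] by simp
  show "\<P>(\<omega> in M. S n \<omega> = 0) = (\<Sum>j\<le>n. (real (n choose j))\<^sup>2 * a ^ j * b ^ (n - j))"
    using **[of n 0] coeff_step_polynomial_power(3)[OF ab] by simp
qed

section \<open>A symmetric lazy walk on path space\<close>

text \<open>The steps come from independent uniform draws among four points: one is sent to -1, one
  to 1 and two to 0.\<close>

lemma symmetric_lazy_walk_exists: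
  "\<exists>(M :: (nat \<Rightarrow> int) measure) S. lazy_simple_random_walk M S
     \<and> \<P>(\<omega> in M. S 1 \<omega> = 1) = 1 / 4 \<and> \<P>(\<omega> in M. S 1 \<omega> = - 1) = 1 / 4"
proof -
  define \<mu> where "\<mu> = measure_pmf (pmf_of_set {0, 1, 2, 3 :: int})"
  define M where "M = PiM (UNIV :: nat set) (\<lambda>_. \<mu>)"
  define f :: "int \<Rightarrow> int" where "f x = (if x = 0 then - 1 else if x = 1 then 1 else 0)" for x
  define X where "X = (\<lambda>i (\<omega> :: nat \<Rightarrow> int). f (\<omega> i))"
  define S where "S = (\<lambda>n \<omega>. \<Sum>i=1..n. X i \<omega>)"
  have \<mu>: "prob_space \<mu>" unfolding \<mu>_def by (rule measure_pmf.prob_space_axioms)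
  interpret prob_space M unfolding M_def by (intro prob_space_PiM \<mu>)
  have f [measurable]: "f \<in> \<mu> \<rightarrow>\<^sub>M count_space UNIV" by (simp add: \<mu>_def)
  have proj [measurable]: "(\<lambda>\<omega>. \<omega> i) \<in> M \<rightarrow>\<^sub>M \<mu>" for i unfolding M_def by simp
  have proj_distr: "distr M \<mu> (\<lambda>\<omega>. \<omega> i) = \<mu>" for i
    unfolding M_def by (intro distr_PiM_component \<mu>) simp
  \<comment> \<open>The joint law of the coordinates is the law of the identity map, that is
    \<open>M\<close> itself, which is the product of the coordinate laws.\<close>
  have "indep_vars (\<lambda>_. \<mu>) (\<lambda>i \<omega>. \<omega> i) (UNIV :: nat set)"
    by (subst indep_vars_iff_distr_eq_PiM)
      (simp_all add: proj_distr restrict_def, simp add: M_def)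
  hence "indep_vars (\<lambda>_. count_space UNIV) X UNIV"
    unfolding X_def by (rule indep_vars_compose2) (rule f)
  hence indep: "indep_vars (\<lambda>_. count_space UNIV) X {1..}"
    by (rule indep_vars_subset) simp
  have X_distr: "distr M (count_space UNIV) (X i) = distr \<mu> (count_space UNIV) f" for i
  proof -
    have "distr \<mu> (count_space UNIV) f = distr (distr M \<mu> (\<lambda>\<omega>. \<omega> i)) (count_space UNIV) f"
      by (simp add: proj_distr)
    also have "\<dots> = distr M (count_space UNIV) (X i)"
      by (subst distr_distr) (auto simp: X_def comp_def)
    finally show ?thesis by simp
  qed
  have X_prob: "\<P>(\<omega> in M. X i \<omega> = m) = measure \<mu> {x. f x = m}" for i m
  proof -
    have X: "X i \<in> M \<rightarrow>\<^sub>M count_space UNIV" unfolding X_def by measurable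
    have "\<P>(\<omega> in M. X i \<omega> = m) = measure (distr M (count_space UNIV) (X i)) {m}"
      using X by (subst measure_distr) (auto intro!: arg_cong[where f = prob])
    also have "\<dots> = measure \<mu> {x. f x = m}"
      unfolding X_distr by (subst measure_distr) (auto simp: \<mu>_def vimage_def)
    finally show ?thesis .
  qed
  have f_prob: "measure \<mu> {x. f x = m} = card {x \<in> {0, 1, 2, 3}. f x = m} / 4" for m
    unfolding \<mu>_def by (subst measure_pmf_of_set) (auto simp: Int_def)
  have sets: "{x \<in> {0, 1, 2, 3}. f x = 0} = {2, 3}" "{x \<in> {0, 1, 2, 3}. f x = 1} = {1}"
    "{x \<in> {0, 1, 2, 3}. f x = - 1} = {0}"
    by (auto simp: f_def)
  have "lazy_simple_random_walk M S"
    unfolding lazy_simple_random_walk_def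
    by (intro conjI exI[of _ X] prob_space_axioms indep)
       (simp_all only: X_distr X_prob f_prob sets, auto simp: S_def X_def f_def)
  moreover have "S 1 = X 1" by (simp add: S_def)
  ultimately show ?thesis
    by (intro exI[of _ M] exI[of _ S]) (simp only: X_prob f_prob sets, simp)
qed

section \<open>Validity and optimality of the exponent\<close>

lemma walk_estimate_critical_exponent:
  assumes "k > 0" "lazy_simple_random_walk M S"
  shows "walk_estimate M S k (critical_exponent k)"
  using homogeneous_inequality[OF assms(1), of "\<P>(\<omega> in M. S 1 \<omega> = 1)" "\<P>(\<omega> in M. S 1 \<omega> = - 1)"]
  unfolding walk_estimate_def lazy_walk_probabilities(2-4)[OF assms(2)]
  by (simp add: add.commute)

text \<open>For the symmetric walk the common factor \<open>((1 / 4) ^ k) powr (1 / p)\<close>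
  cancels and the estimate reduces to \<open>C powr (1 / p) \<le> 2\<close>, which bounds
  \<open>p\<close> from below by the binary logarithm of \<open>C\<close>.\<close>

lemma critical_exponent_le_universal_exponent:
  assumes "p > 0" "universal_exponent k p"
  shows "critical_exponent k \<le> p"
proof -
  obtain M :: "(nat \<Rightarrow> int) measure" and S where walk: "lazy_simple_random_walk M S"
    and quarter: "\<P>(\<omega> in M. S 1 \<omega> = 1) = 1 / 4" "\<P>(\<omega> in M. S 1 \<omega> = - 1) = 1 / 4"
    using symmetric_lazy_walk_exists by blast
  define C where "C = real ((2 * k) choose k)"
  have C: "C > 0" by (simp add: C_def zero_less_binomial_iff)
  have sum: "(\<Sum>j\<le>k. (real (k choose j))\<^sup>2 * (1 / 4) ^ j * (1 / 4) ^ (k - j)) = C * (1 / 4) ^ k"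
    unfolding C_def binomial_square_sum_1[symmetric] binomial_square_sum_def sum_distrib_right
    by (intro sum.cong refl) (simp add: mult.assoc flip: power_add)
  have "walk_estimate M S k p" using assms(2) walk unfolding universal_exponent_def by blast
  hence "(C * (1 / 4) ^ k) powr (1 / p) \<le> 2 * ((1 / 4) ^ k) powr (1 / p)"
    unfolding walk_estimate_def lazy_walk_probabilities(2-4)[OF walk] quarter sum by simp
  hence "C powr (1 / p) \<le> 2"
    using C by (simp add: powr_mult)
  hence "(C powr (1 / p)) powr p \<le> 2 powr p"
    using assms(1) by (intro powr_mono2) auto
  hence "C \<le> 2 powr p" using assms(1) C by (simp add: powr_powr)
  thus ?thesis using C by (simp add: critical_exponent_def C_def log_le_iff)
qed

theorem corollary3:
  fixes k :: nat
  assumes "k > 0"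
  shows "(\<forall>(M :: 'a measure) S. lazy_simple_random_walk M S \<longrightarrow> walk_estimate M S k (critical_exponent k))
    \<and> critical_exponent k > 0
    \<and> universal_exponent k (critical_exponent k)
    \<and> (\<forall>p::real. p > 0 \<and> universal_exponent k p \<longrightarrow> critical_exponent k \<le> p)"
  using assms by (simp add: walk_estimate_critical_exponent critical_exponent_pos
      critical_exponent_le_universal_exponent universal_exponent_def)

end
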